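(* For all $n\ge1$ and $0\le k\le n$, $$M_{k,2n}=\frac{n+1}{k+1}\binom{n-1}{k}\binom{n}{k}(n!)^2=\binom{n-1}{k}\binom{n+1}{k+1}(n!)^2$$ and $$M_{k,2n+1}=\frac{1}{n-k+1}\binom{n}{k}^2((n+1)!)^2=\binom{n}{k}\binom{n+1}{k}n!(n+1)!.$$
   Context: $\mathcal{S}_m$ denotes the set of permutations $\sigma=\sigma_1\cdots\sigma_m$ of $\{1,\dots,m\}$. $\overleftarrow{des}_O(\sigma)$ is the number of indices $i\in\{1,\dots,m-1\}$ with $\sigma_i>\sigma_{i+1}$ and $\sigma_i$ odd. $M_{k,m}$ is the number of $\sigma\in\mathcal{S}_m$ with $\overleftarrow{des}_O(\sigma)=k$. Binomial coefficients $\binom{a}{b}$ are $0$ when $b<0$ or $b>a$. *)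

theory Defs
  imports Complex_Main "HOL-Combinatorics.Permutations"
begin

definition des_odd :: "nat \<Rightarrow> (nat \<Rightarrow> nat) \<Rightarrow> nat" where
  "des_odd m \<sigma> = card {i \<in> {1..<m}. \<sigma> i > \<sigma> (i + 1) \<and> odd (\<sigma> i)}"

definition M :: "nat \<Rightarrow> nat \<Rightarrow> nat" where
  "M k m = card {\<sigma>. \<sigma> permutes {1..m} \<and> des_odd m \<sigma> = k}"

end

theory Submission
  imports Defs "HOL-Combinatorics.Multiset_Permutations"
begin

text \<open>
  Insert the new maximum \<open>m + 1\<close> into a permutation of \<open>{1..m}\<close> with \<open>d\<close> descents from odd values.
  If \<open>m + 1\<close> is odd, the \<open>d\<close> descent gaps and the final position keep \<open>d\<close>, and each of the other
  \<open>m - d\<close> gaps raises it by one; if \<open>m + 1\<close> is even, the \<open>d\<close> descent gaps lower it by one and all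
  other gaps keep it. The product formulas solve the two resulting recurrences.
\<close>

section \<open>Odd descents of lists\<close>

fun list_des_odd :: "nat list \<Rightarrow> nat" where
  "list_des_odd [] = 0"
| "list_des_odd [x] = 0"
| "list_des_odd (x # y # xs) = (if x > y \<and> odd x then 1 else 0) + list_des_odd (y # xs)"

text \<open>A position \<open>i\<close> denotes the gap between entries \<open>i - 1\<close> and \<open>i\<close>.\<close>

definition odd_descent_gaps :: "nat list \<Rightarrow> nat set" where
  "odd_descent_gaps xs = {i. 0 < i \<and> i < length xs \<and> xs ! (i - 1) > xs ! i \<and> odd (xs ! (i - 1))}"

lemma odd_descent_gaps_subset: "odd_descent_gaps xs \<subseteq> {..<length xs}"
  by (auto simp: odd_descent_gaps_def)

lemma finite_odd_descent_gaps [simp]: "finite (odd_descent_gaps xs)"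
  using odd_descent_gaps_subset finite_subset by blast

lemma odd_descent_gaps_Cons:
  "odd_descent_gaps (x # y # xs) =
     (if x > y \<and> odd x then {1} else {}) \<union> Suc ` odd_descent_gaps (y # xs)"
  (is "?L = ?R")
proof (rule set_eqI)
  fix i show "i \<in> ?L \<longleftrightarrow> i \<in> ?R"
  proof (cases i)
    case 0
    then show ?thesis by (auto simp: odd_descent_gaps_def)
  next
    case (Suc j)
    then show ?thesis
      by (cases j) (auto simp: odd_descent_gaps_def image_iff)
  qed
qed

text \<open>Links the recursive count, suited to concatenation, with a set of positions, suited to
  counting where a new entry can go.\<close>

lemma card_odd_descent_gaps: "card (odd_descent_gaps xs) = list_des_odd xs"
proof (induction xs rule: list_des_odd.induct)
  case (3 x y xs)
  have "1 \<notin> Suc ` odd_descent_gaps (y # xs)"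
    by (auto simp: odd_descent_gaps_def)
  then show ?case
    using 3 by (auto simp: odd_descent_gaps_Cons card_image)
qed (auto simp: odd_descent_gaps_def)

lemma list_des_odd_append:
  "list_des_odd (us @ vs) = list_des_odd us + list_des_odd vs +
     (if us \<noteq> [] \<and> vs \<noteq> [] \<and> last us > hd vs \<and> odd (last us) then 1 else 0)"
proof (induction us rule: list_des_odd.induct)
  case (2 x)
  then show ?case by (cases vs) auto
qed auto

section \<open>Effect of inserting a new maximum\<close>

definition insert_at :: "nat \<Rightarrow> 'a \<Rightarrow> 'a list \<Rightarrow> 'a list" where
  "insert_at i a ys = take i ys @ a # drop i ys"

lemma list_des_odd_split:
  assumes "i \<le> length ys"
  shows "list_des_odd ys = list_des_odd (take i ys) + list_des_odd (drop i ys) +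
           (if i \<in> odd_descent_gaps ys then 1 else 0)"
proof -
  have "(take i ys \<noteq> [] \<and> drop i ys \<noteq> [] \<and> last (take i ys) > hd (drop i ys) \<and> odd (last (take i ys)))
          \<longleftrightarrow> i \<in> odd_descent_gaps ys"
  proof (cases "0 < i \<and> i < length ys")
    case True
    then have "take i ys \<noteq> []" by auto
    from last_conv_nth[OF this] True have "last (take i ys) = ys ! (i - 1)" "hd (drop i ys) = ys ! i"
      by (simp_all add: hd_drop_conv_nth)
    with True show ?thesis by (auto simp: odd_descent_gaps_def)
  next
    case False
    then show ?thesis by (auto simp: odd_descent_gaps_def)
  qed
  then show ?thesis
    using list_des_odd_append[of "take i ys" "drop i ys"] by simp
qed

text \<open>Only the junction changes. A descent at gap \<open>i\<close> is lost, the step up to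
  \<open>a\<close> is never a descent, and \<open>a\<close> starts one exactly when it is odd and
  not last. Keeping the loss on the left avoids truncated subtraction.\<close>

lemma list_des_odd_insert_at:
  assumes "i \<le> length ys" and less: "\<And>y. y \<in> set ys \<Longrightarrow> y < a"
  shows "list_des_odd (insert_at i a ys) + (if i \<in> odd_descent_gaps ys then 1 else 0) =
         list_des_odd ys + (if i < length ys \<and> odd a then 1 else 0)"
proof -
  have "\<not> last (take i ys) > a" if "take i ys \<noteq> []"
    using less[of "last (take i ys)"] last_in_set[OF that] in_set_takeD[of _ i ys] by fastforce
  moreover have "list_des_odd (a # drop i ys) =
      list_des_odd (drop i ys) + (if i < length ys \<and> odd a then 1 else 0)"
  proof (cases "drop i ys")
    case (Cons z zs)
    then have "z < a" using less in_set_dropD[of z i ys] by simp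
    with Cons show ?thesis by (cases "i < length ys") auto
  qed auto
  ultimately show ?thesis
    using list_des_odd_split[OF assms(1)]
    by (auto simp: insert_at_def list_des_odd_append)
qed

lemma card_insert_at_odd:
  assumes "odd a" and less: "\<And>y. y \<in> set ys \<Longrightarrow> y < a"
  shows "card {i \<in> {..length ys}. list_des_odd (insert_at i a ys) = k} =
         (if list_des_odd ys = k then k + 1 else 0) +
         (if Suc (list_des_odd ys) = k then length ys - list_des_odd ys else 0)"
proof -
  \<comment> \<open>\<open>G\<close> collects the gaps that leave the count unchanged: at a descent
    gap the new descent replaces the lost one, and at the end nothing follows \<open>a\<close>. The
    end is not a descent gap, hence the \<open>Suc\<close> in the cardinality.\<close>
  define G where "G = insert (length ys) (odd_descent_gaps ys)"
  have G: "finite G" "G \<subseteq> {..length ys}" "card G = Suc (list_des_odd ys)"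
    using odd_descent_gaps_subset[of ys]
    by (auto simp: G_def card_odd_descent_gaps card_insert_if)
  have des: "list_des_odd (insert_at i a ys) = list_des_odd ys + (if i \<in> G then 0 else 1)"
    if "i \<le> length ys" for i
    using list_des_odd_insert_at[OF that less] that assms(1) odd_descent_gaps_subset[of ys]
    by (auto simp: G_def split: if_splits)
  have "{i \<in> {..length ys}. list_des_odd (insert_at i a ys) = k} =
        (if list_des_odd ys = k then G else {}) \<union>
        (if Suc (list_des_odd ys) = k then {..length ys} - G else {})"
    using G(2) by (auto simp: des split: if_splits)
  then show ?thesis
    using G by (auto simp: card_Diff_subset)
qed

text \<open>An even maximum creates no odd descent, so \<open>k\<close> is reached either from
  \<open>k\<close> through a gap without odd descent or from \<open>Suc k\<close> by breaking one of
  its \<open>Suc k\<close> odd descents.\<close>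

lemma card_insert_at_even:
  assumes "even a" and less: "\<And>y. y \<in> set ys \<Longrightarrow> y < a"
  shows "card {i \<in> {..length ys}. list_des_odd (insert_at i a ys) = k} =
         (if list_des_odd ys = k then Suc (length ys) - k else 0) +
         (if list_des_odd ys = Suc k then Suc k else 0)"
proof -
  define G where "G = odd_descent_gaps ys"
  have G: "finite G" "G \<subseteq> {..length ys}" "card G = list_des_odd ys"
    using odd_descent_gaps_subset[of ys]
    by (auto simp: G_def card_odd_descent_gaps)
  have des: "list_des_odd (insert_at i a ys) + (if i \<in> G then 1 else 0) = list_des_odd ys"
    if "i \<le> length ys" for i
    using list_des_odd_insert_at[OF that less] assms(1) by (auto simp: G_def)
  have "{i \<in> {..length ys}. list_des_odd (insert_at i a ys) = k} =
        (if list_des_odd ys = k then {..length ys} - G else {}) \<union>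
        (if list_des_odd ys = Suc k then G else {})"
    (is "?L = ?R")
  proof (rule set_eqI)
    fix i show "i \<in> ?L \<longleftrightarrow> i \<in> ?R"
      using des[of i] G(2) by (cases "i \<in> G") auto
  qed
  then show ?thesis
    using G by (auto simp: card_Diff_subset)
qed

section \<open>Bijections behind the counting\<close>

lemma bij_betw_insert_at:
  fixes A :: "'a set"
  assumes "finite A" "a \<notin> A"
  shows "bij_betw (\<lambda>(ys, i). insert_at i a ys) (permutations_of_set A \<times> {..card A})
           (permutations_of_set (insert a A))"
proof (rule bij_betwI')
  have eq: "i = j \<and> ys = zs"
    if "ys \<in> permutations_of_set A" "zs \<in> permutations_of_set A" "i \<le> card A" "j \<le> card A"
      "insert_at i a ys = insert_at j a zs" for ys zs i j
  proof -
    have "a \<notin> set (take i ys)" "a \<notin> set (drop i ys)"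
      using that assms by (auto simp: permutations_of_set_def dest: in_set_takeD in_set_dropD)
    \<comment> \<open>The unique occurrence of \<open>a\<close> determines what stands before and
      after it.\<close>
    from append_Cons_eq_iff[OF this] that(5)
    have "take i ys = take j zs \<and> drop i ys = drop j zs"
      by (simp add: insert_at_def)
    moreover have "length ys = card A" "length zs = card A"
      using that(1,2) distinct_card[of ys] distinct_card[of zs]
      by (simp_all add: permutations_of_set_def)
    \<comment> \<open>The bound by \<open>card A\<close> makes \<open>i\<close> the length of
      \<open>take i ys\<close>; beyond it, all \<open>i\<close> would give the same list.\<close>
    ultimately show ?thesis
      using that(3,4) by (metis append_take_drop_id length_take min.absorb2)
  qed
  fix p q
  assume "p \<in> permutations_of_set A \<times> {..card A}" "q \<in> permutations_of_set A \<times> {..card A}"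
  then show "((case p of (ys, i) \<Rightarrow> insert_at i a ys) = (case q of (ys, i) \<Rightarrow> insert_at i a ys)) = (p = q)"
    using eq by auto
next
  fix p
  assume "p \<in> permutations_of_set A \<times> {..card A}"
  then obtain ys i where p: "p = (ys, i)" "set ys = A" "distinct ys"
    by (auto simp: permutations_of_set_def)
  define us vs where uv: "us = take i ys" "vs = drop i ys"
  then have "ys = us @ vs" by simp
  then have "set (us @ a # vs) = insert a A" "distinct (us @ a # vs)"
    using p(2,3) assms by auto
  then show "(case p of (ys, i) \<Rightarrow> insert_at i a ys) \<in> permutations_of_set (insert a A)"
    unfolding p(1) uv by (simp add: permutations_of_set_def insert_at_def)
next
  fix xs
  assume xs: "xs \<in> permutations_of_set (insert a A)"
  then obtain us vs where uv: "xs = us @ a # vs"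
    by (metis insertI1 permutations_of_setD(1) split_list)
  with xs assms have "set (us @ vs) = A" "distinct (us @ vs)"
    by (auto simp: permutations_of_set_def)
  then have "us @ vs \<in> permutations_of_set A" "length us \<le> card A"
    by (auto simp: permutations_of_set_def card_mono simp flip: distinct_card)
  moreover have "xs = insert_at (length us) a (us @ vs)"
    using uv by (simp add: insert_at_def)
  ultimately show "\<exists>p \<in> permutations_of_set A \<times> {..card A}. xs = (case p of (ys, i) \<Rightarrow> insert_at i a ys)"
    by (intro bexI[of _ "(us @ vs, length us)"]) auto
qed

lemma bij_betw_map_permutes:
  "bij_betw (\<lambda>\<sigma>. map \<sigma> [1..<Suc m]) {\<sigma>. \<sigma> permutes {1..m}} (permutations_of_set {1..m})"
proof -
  let ?f = "\<lambda>\<sigma>. map \<sigma> [1..<Suc m]"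
  have inj: "inj_on ?f {\<sigma>. \<sigma> permutes {1..m}}"
  proof (rule inj_onI, rule ext)
    fix \<sigma> \<tau> x
    assume "\<sigma> \<in> {\<sigma>. \<sigma> permutes {1..m}}" "\<tau> \<in> {\<sigma>. \<sigma> permutes {1..m}}" "?f \<sigma> = ?f \<tau>"
    then show "\<sigma> x = \<tau> x"
      by (cases "x \<in> {1..m}") (auto simp: permutes_not_in simp del: upt_Suc)
  qed
  moreover have "?f ` {\<sigma>. \<sigma> permutes {1..m}} \<subseteq> permutations_of_set {1..m}"
  proof clarify
    fix \<sigma> assume \<sigma>: "\<sigma> permutes {1..m}"
    have "set [1..<Suc m] = {1..m}" by auto
    then show "?f \<sigma> \<in> permutations_of_set {1..m}"
      using permutes_image[OF \<sigma>] permutes_inj_on[OF \<sigma>, of "{1..m}"]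
      by (simp add: permutations_of_set_def distinct_map del: upt_Suc)
  qed
  \<comment> \<open>Surjectivity comes from counting: both sides have \<open>fact m\<close>
    elements.\<close>
  moreover have "card (?f ` {\<sigma>. \<sigma> permutes {1..m}}) = card (permutations_of_set {1..m})"
    using card_image[OF inj] by (simp add: card_permutations[of _ m])
  ultimately show ?thesis
    unfolding bij_betw_def by (metis card_subset_eq finite_permutations_of_set)
qed

text \<open>Lists are indexed from 0 and permutations from 1, so gap \<open>i\<close>, between list
  entries \<open>i - 1\<close> and \<open>i\<close>, is exactly the descent position
  \<open>i\<close> of \<sigma>.\<close>

lemma list_des_odd_map: "list_des_odd (map \<sigma> [1..<Suc m]) = des_odd m \<sigma>"
proof -
  have "odd_descent_gaps (map \<sigma> [1..<Suc m]) = {i \<in> {1..<m}. \<sigma> i > \<sigma> (i + 1) \<and> odd (\<sigma> i)}"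
    by (auto simp: odd_descent_gaps_def simp del: upt_Suc)
  then show ?thesis
    by (simp add: des_odd_def flip: card_odd_descent_gaps)
qed

lemma M_eq_card_lists:
  "M k m = card {xs \<in> permutations_of_set {1..m}. list_des_odd xs = k}"
proof -
  have "bij_betw (\<lambda>\<sigma>. map \<sigma> [1..<Suc m]) {\<sigma> \<in> {\<sigma>. \<sigma> permutes {1..m}}. des_odd m \<sigma> = k}
          {xs \<in> permutations_of_set {1..m}. list_des_odd xs = k}"
    unfolding bij_betw_def
  proof
    let ?f = "\<lambda>\<sigma>. map \<sigma> [1..<Suc m]"
    show "inj_on ?f {\<sigma> \<in> {\<sigma>. \<sigma> permutes {1..m}}. des_odd m \<sigma> = k}"
      by (rule inj_on_subset[OF bij_betw_imp_inj_on[OF bij_betw_map_permutes]]) auto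
    show "?f ` {\<sigma> \<in> {\<sigma>. \<sigma> permutes {1..m}}. des_odd m \<sigma> = k} =
          {xs \<in> permutations_of_set {1..m}. list_des_odd xs = k}"
      unfolding bij_betw_imp_surj_on[OF bij_betw_map_permutes, symmetric] list_des_odd_map[symmetric]
      by blast
  qed
  then show ?thesis
    unfolding M_def using bij_betw_same_card by fastforce
qed

text \<open>Each permutation of \<open>{1..Suc m}\<close> arises from exactly one pair of a shorter
  permutation and an insertion position; the pairs are grouped by the shorter permutation.\<close>

lemma M_Suc_eq_sum:
  "M k (Suc m) = (\<Sum>ys\<in>permutations_of_set {1..m}.
     card {i \<in> {..m}. list_des_odd (insert_at i (Suc m) ys) = k})"
proof -
  let ?P = "permutations_of_set {1..m}"
  let ?f = "\<lambda>(ys, i). insert_at i (Suc m) ys"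
  have bij: "bij_betw ?f (?P \<times> {..m}) (permutations_of_set {1..Suc m})"
    using bij_betw_insert_at[of "{1..m}" "Suc m"] by (simp add: atLeastAtMostSuc_conv)
  have "bij_betw ?f (SIGMA ys:?P. {i \<in> {..m}. list_des_odd (insert_at i (Suc m) ys) = k})
          {xs \<in> permutations_of_set {1..Suc m}. list_des_odd xs = k}"
    unfolding bij_betw_def
  proof
    show "inj_on ?f (SIGMA ys:?P. {i \<in> {..m}. list_des_odd (insert_at i (Suc m) ys) = k})"
      by (rule inj_on_subset[OF bij_betw_imp_inj_on[OF bij]]) auto
    show "?f ` (SIGMA ys:?P. {i \<in> {..m}. list_des_odd (insert_at i (Suc m) ys) = k}) =
          {xs \<in> permutations_of_set {1..Suc m}. list_des_odd xs = k}"
      unfolding bij_betw_imp_surj_on[OF bij, symmetric] by (auto simp: image_iff)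
  qed
  then show ?thesis
    by (simp add: M_eq_card_lists flip: bij_betw_same_card)
qed

lemma sum_list_des_odd_eq:
  "(\<Sum>ys\<in>permutations_of_set {1..m}. if list_des_odd ys = k then c else 0) = c * M k m"
  by (simp add: M_eq_card_lists sum.If_cases Int_def)

section \<open>The two recurrences\<close>

lemma M_Suc_odd:
  assumes "even m"
  shows "M 0 (Suc m) = M 0 m"
    and "M (Suc k) (Suc m) = (k + 2) * M (Suc k) m + (m - k) * M k m"
proof -
  have "M k (Suc m) = (\<Sum>ys\<in>permutations_of_set {1..m}.
          (if list_des_odd ys = k then k + 1 else 0) +
          (if Suc (list_des_odd ys) = k then m - list_des_odd ys else 0))" for k
    unfolding M_Suc_eq_sum
  proof (rule sum.cong[OF refl])
    fix ys assume "ys \<in> permutations_of_set {1..m}"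
    then have ys: "length ys = m" "set ys = {1..m}"
      using distinct_card[of ys] by (auto simp: permutations_of_set_def)
    show "card {i \<in> {..m}. list_des_odd (insert_at i (Suc m) ys) = k} =
          (if list_des_odd ys = k then k + 1 else 0) +
          (if Suc (list_des_odd ys) = k then m - list_des_odd ys else 0)"
      using card_insert_at_odd[of "Suc m" ys k] ys assms by simp
  qed
  note eq = this
  show "M 0 (Suc m) = M 0 m"
    using eq[of 0] sum_list_des_odd_eq[where k = 0 and c = 1 and m = m] by (simp cong: if_cong)
  have "M (Suc k) (Suc m) = (\<Sum>ys\<in>permutations_of_set {1..m}.
          (if list_des_odd ys = Suc k then k + 2 else 0) +
          (if list_des_odd ys = k then m - k else 0))"
    \<comment> \<open>The condition fixes \<open>list_des_odd ys\<close> to \<open>k\<close>, which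
      turns each summand into a constant times an indicator.\<close>
    unfolding eq by (rule sum.cong) auto
  then show "M (Suc k) (Suc m) = (k + 2) * M (Suc k) m + (m - k) * M k m"
    by (simp only: sum.distrib sum_list_des_odd_eq)
qed

lemma M_Suc_even:
  assumes "odd m"
  shows "M k (Suc m) = (Suc m - k) * M k m + Suc k * M (Suc k) m"
proof -
  have "M k (Suc m) = (\<Sum>ys\<in>permutations_of_set {1..m}.
          (if list_des_odd ys = k then Suc m - k else 0) +
          (if list_des_odd ys = Suc k then Suc k else 0))"
    unfolding M_Suc_eq_sum
  proof (rule sum.cong[OF refl])
    fix ys assume "ys \<in> permutations_of_set {1..m}"
    then have ys: "length ys = m" "set ys = {1..m}"
      using distinct_card[of ys] by (auto simp: permutations_of_set_def)
    show "card {i \<in> {..m}. list_des_odd (insert_at i (Suc m) ys) = k} =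
          (if list_des_odd ys = k then Suc m - k else 0) +
          (if list_des_odd ys = Suc k then Suc k else 0)"
      using card_insert_at_even[of "Suc m" ys k] ys assms by simp
  qed
  then show ?thesis
    by (simp only: sum.distrib sum_list_des_odd_eq)
qed

section \<open>Solving the recurrences\<close>

lemma M_1: "M k 1 = (if k = 0 then 1 else 0)"
proof -
  have "{xs \<in> permutations_of_set {1..1}. list_des_odd xs = k} = (if k = 0 then {[1]} else {})"
    by auto
  then show ?thesis by (simp add: M_eq_card_lists)
qed

text \<open>Over the reals the identity needs no bound on \<open>k\<close>: for \<open>k > n\<close>
  both binomials vanish.\<close>

lemma Suc_times_binomial_Suc_real:
  "(real k + 1) * real (n choose Suc k) = (real n - real k) * real (n choose k)"
proof (cases "k \<le> n")
  case True
  have "Suc k * (n choose Suc k) = (n - k) * (n choose k)"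
    by (simp only: binomial_absorb_comp binomial_absorption)
  from arg_cong[OF this, of real] True show ?thesis
    by (simp add: of_nat_diff algebra_simps)
qed (simp add: binomial_eq_0)

text \<open>Inserts the even maximum \<open>2 * n + 2\<close>. The conclusion is the even formula
  with \<open>n + 1\<close> for \<open>n\<close>, a shift that avoids \<open>n - 1\<close>.\<close>

lemma M_even_step:
  assumes odd: "\<And>k. real (M k (2 * n + 1)) =
      real (n choose k) * real ((n + 1) choose k) * fact n * fact (n + 1)"
  shows "real (M k (2 * n + 2)) =
      real (n choose k) * real ((n + 2) choose (k + 1)) * (fact (n + 1))\<^sup>2"
proof -
  have "real (M k (2 * n + 2)) =
      real (2 * n + 2 - k) * real (M k (2 * n + 1)) + (real k + 1) * real (M (k + 1) (2 * n + 1))"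
    using M_Suc_even[of "2 * n + 1" k] by (simp add: distrib_right)
  \<comment> \<open>Truncation is harmless: for \<open>k > n\<close> the factor
    \<open>M k (2 * n + 1)\<close> is 0.\<close>
  also have "real (2 * n + 2 - k) * real (M k (2 * n + 1)) =
      (2 * real n + 2 - real k) * real (M k (2 * n + 1))"
    using odd[of k] by (cases "k \<le> n") (simp_all add: of_nat_diff binomial_eq_0)
  also have "\<dots> + (real k + 1) * real (M (k + 1) (2 * n + 1)) =
      ((2 * real n + 2 - real k) * real (n choose k) * real ((n + 1) choose k) +
       ((real k + 1) * real (n choose Suc k)) * real ((n + 1) choose Suc k)) * (fact n * fact (n + 1))"
    unfolding odd by (simp add: algebra_simps)
  \<comment> \<open>Absorption in \<open>n choose Suc k\<close> exposes the common factor
    \<open>n choose k\<close>.\<close>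
  also have "\<dots> = real (n choose k) * ((2 * real n + 2 - real k) * real ((n + 1) choose k) +
       (real n - real k) * real ((n + 1) choose Suc k)) * (fact n * fact (n + 1))"
    unfolding Suc_times_binomial_Suc_real by (simp add: algebra_simps)
  \<comment> \<open>Split the coefficient as \<open>(n + 1 - k) + (n + 1)\<close>. Absorption turns
    the first part into \<open>(k + 1) * ((n + 1) choose Suc k)\<close>, and Pascal's rule combines
    the rest.\<close>
  also have "(2 * real n + 2 - real k) * real ((n + 1) choose k) +
       (real n - real k) * real ((n + 1) choose Suc k) =
       (real n + 1) * real ((n + 2) choose (k + 1))"
    using Suc_times_binomial_Suc_real[of k "n + 1"] by (simp add: algebra_simps)
  finally show ?thesis
    by (simp add: power2_eq_square algebra_simps)
qed

lemma M_odd_step: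
  assumes even: "\<And>k. real (M k (2 * n + 2)) =
      real (n choose k) * real ((n + 2) choose (k + 1)) * (fact (n + 1))\<^sup>2"
  shows "real (M k (2 * n + 3)) =
      real ((n + 1) choose k) * real ((n + 2) choose k) * fact (n + 1) * fact (n + 2)"
proof (cases k)
  case 0
  have "M 0 (2 * n + 3) = M 0 (2 * n + 2)"
    using M_Suc_odd(1)[of "2 * n + 2"] by (simp add: numeral_3_eq_3)
  then show ?thesis
    using even[of 0] 0 by (simp add: power2_eq_square algebra_simps)
next
  case (Suc j)
  have "real (M k (2 * n + 3)) =
      (real j + 2) * real (M (Suc j) (2 * n + 2)) + real (2 * n + 2 - j) * real (M j (2 * n + 2))"
    using M_Suc_odd(2)[of "2 * n + 2" j] Suc by (simp add: numeral_3_eq_3 distrib_right)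
  \<comment> \<open>As before, \<open>M j (2 * n + 2)\<close> vanishes for
    \<open>j > n\<close>.\<close>
  also have "real (2 * n + 2 - j) * real (M j (2 * n + 2)) =
      (2 * real n + 2 - real j) * real (M j (2 * n + 2))"
    using even[of j] by (cases "j \<le> n") (simp_all add: of_nat_diff binomial_eq_0)
  also have "(real j + 2) * real (M (Suc j) (2 * n + 2)) + \<dots> =
      (((real (Suc j) + 1) * real ((n + 2) choose Suc (Suc j))) * real (n choose Suc j) +
       (2 * real n + 2 - real j) * real (n choose j) * real ((n + 2) choose Suc j)) * (fact (n + 1))\<^sup>2"
    unfolding even by (simp add: algebra_simps)
  \<comment> \<open>Here absorption is applied to \<open>(n + 2) choose Suc (Suc j)\<close>, leaving
    \<open>(n + 2) choose Suc j\<close> as the common factor.\<close>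
  also have "\<dots> = real ((n + 2) choose Suc j) *
      ((real n + 1 - real j) * real (n choose Suc j) +
       (2 * real n + 2 - real j) * real (n choose j)) * (fact (n + 1))\<^sup>2"
    unfolding Suc_times_binomial_Suc_real by (simp add: algebra_simps)
  \<comment> \<open>Split the second coefficient as \<open>(n - j) + (n + 2)\<close>; after
    absorption both binomials have coefficient \<open>n + 2\<close>, and Pascal's rule
    applies.\<close>
  also have "(real n + 1 - real j) * real (n choose Suc j) +
       (2 * real n + 2 - real j) * real (n choose j) = (real n + 2) * real ((n + 1) choose Suc j)"
    using Suc_times_binomial_Suc_real[of j n] by (simp add: algebra_simps)
  finally show ?thesis
    using Suc by (simp add: power2_eq_square algebra_simps)
qed

text \<open>One induction step performs two insertions, an even maximum and then an odd one,
  starting from the single permutation of \<open>{1}\<close>.\<close>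

lemma M_odd_closed_form:
  "real (M k (2 * n + 1)) = real (n choose k) * real ((n + 1) choose k) * fact n * fact (n + 1)"
proof (induction n arbitrary: k)
  case 0
  then show ?case using M_1[of k] by (cases k) auto
next
  case (Suc n)
  show ?case
    using M_odd_step[OF M_even_step[OF Suc.IH], of k] by (simp add: numeral_3_eq_3)
qed

theorem theorem6p1:
  fixes n k :: nat
  assumes "n \<ge> 1" and "k \<le> n"
  shows "real (M k (2 * n)) =
           (real n + 1) / (real k + 1) * real ((n - 1) choose k) * real (n choose k) * (fact n)\<^sup>2
       \<and> (real n + 1) / (real k + 1) * real ((n - 1) choose k) * real (n choose k) * (fact n)\<^sup>2 =
           real ((n - 1) choose k) * real ((n + 1) choose (k + 1)) * (fact n)\<^sup>2
       \<and> real (M k (2 * n + 1)) =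
           1 / (real n - real k + 1) * (real (n choose k))\<^sup>2 * (fact (n + 1))\<^sup>2
       \<and> 1 / (real n - real k + 1) * (real (n choose k))\<^sup>2 * (fact (n + 1))\<^sup>2 =
           real (n choose k) * real ((n + 1) choose k) * fact n * fact (n + 1)"
proof -
  \<comment> \<open>The even formula for \<open>n\<close> comes from the odd one for its
    predecessor.\<close>
  obtain p where p: "n = Suc p"
    using assms(1) by (cases n) auto
  have even: "real (M k (2 * n)) =
      real ((n - 1) choose k) * real ((n + 1) choose (k + 1)) * (fact n)\<^sup>2"
    using M_even_step[OF M_odd_closed_form, of k p] p by simp
  have absorb: "(real k + 1) * real ((n + 1) choose (k + 1)) = (real n + 1) * real (n choose k)"
    using arg_cong[OF Suc_times_binomial_eq[of n k], of real] by (simp add: algebra_simps)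
  then have even_alt: "real ((n + 1) choose (k + 1)) = (real n + 1) / (real k + 1) * real (n choose k)"
    by (simp add: field_simps)
  have "(real n + 1 - real k) * real ((n + 1) choose k) = (real n + 1) * real (n choose k)"
    using Suc_times_binomial_Suc_real[of k "n + 1"] absorb by (simp add: add.commute)
  \<comment> \<open>Division is safe since \<open>k \<le> n\<close> makes \<open>n - k + 1\<close>
    positive.\<close>
  then have odd_alt: "real ((n + 1) choose k) = (real n + 1) / (real n - real k + 1) * real (n choose k)"
    using assms(2) by (simp add: field_simps)
  show ?thesis
    unfolding even M_odd_closed_form even_alt odd_alt
    by (simp add: power2_eq_square)
qed

end
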